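(* Let $k\ge 1$, let $X=\{1,2,\ldots,d\}$ and let $P$ be a symmetric set of permutations of $X$ with $d=|P|^{2k}$. Let $S_P=\{s_{(\pi,\tau)}:\pi,\tau\in P\}$ be the generating set, defined by the wreath recursion given in the context, of the self-similar group $G_{P,k}=\langle S_P\rangle$ acting on $X^*$, and let $\Gamma_n$ ($n\ge 1$) be the action graph of $S_P$ on $X^n$. Let $\Gamma$ be the graph of the action of $P$ on $X$. Then for every $n\ge 1$, $$\Gamma_{n+1}=\Gamma_n^k\,ⓩ\,\Gamma ,$$ where $\Gamma_n^k$ is the $k$-th power of $\Gamma_n$, $ⓩ$ denotes the zig-zag product, the vertex $(x,v)\in X\times X^n$ of the product is identified with $xv\in X^{n+1}$, and the edges of $\Gamma_n^k$ at each vertex $v\in X^n$ are labeled by the vertices of $\Gamma$ via $v[x]:=w_x(v)$, $x\in X$, with $w_x$ the words defined in the context (so the edge labeled $x$ at $v$ is labeled $\gamma(x)$ at $w_x(v)$).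
   Context: Graphs are regular, undirected, and may have loops and multiple edges. A set of permutations is symmetric if it is closed under inverses. Action graphs: if a finite family $S$ of generators, closed under inverses, acts on a set $V$, the action graph has vertex set $V$ and, for every $s\in S$ and $v\in V$, an edge between $v$ and $s(v)$; the edge given by $s$ at $v$ is the same undirected edge as the one given by $s^{-1}$ at $s(v)$, so the graph is $|S|$-regular (generators are counted as formal symbols). Equality of graphs is with multiplicities of edges. The $k$-th power $\Delta^k$ of a graph $\Delta$ is the graph on the vertices of $\Delta$ in which each edge corresponds to a path (walk) of length $k$ in $\Delta$; the edges of $\Gamma_n^k$ at $v$ thus correspond to the words of length $k$ over $S_P$ applied to $v$. Wreath recursion: $X^*$ is the set of finite words over $X$. There are $|S_P|^k=d$ words of length $k$ over the set of formal symbols $S_P$; fix an order on them: $w_1,\ldots,w_d$. Let $\gamma$ be the involution on $X$ such that if $w_x=s_{(\pi_1,\tau_1)}s_{(\pi_2,\tau_2)}\cdots s_{(\pi_k,\tau_k)}$ then $w_{\gamma(x)}=s_{(\tau_k^{-1},\pi_k^{-1})}\cdots s_{(\tau_2^{-1},\pi_2^{-1})}s_{(\tau_1^{-1},\pi_1^{-1})}$. The symbols act on $X^*$ (left actions, fixing the empty word, preserving length) by the recursive rule $$s_{(\pi,\tau)}(xv)=\tau(\gamma(\pi(x)))\,w_{\pi(x)}(v),\qquad x\in X,\ v\in X^*,$$ where words act by composition. These are invertible transformations with $s_{(\pi,\tau)}^{-1}=s_{(\tau^{-1},\pi^{-1})}$, and $G_{P,k}$ is the group they generate under composition. Zig-zag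 product: let $\mathcal G$ be a $D$-regular graph and $\Gamma$ a $\delta$-regular graph on $D$ vertices. The edges at each vertex of $\mathcal G$ are labeled by the vertices of $\Gamma$ in one-to-one fashion; $v[x]$ denotes the neighbor of $v$ along the edge labeled $x$ at $v$. The zig-zag product $\mathcal G\,ⓩ\,\Gamma$ is the $\delta^2$-regular graph with vertex set $V(\Gamma)\times V(\mathcal G)$ whose edges are as follows: for every edge $x - x'$ of $\Gamma$, the edge of $\mathcal G$ joining $v$ and $u=v[x']$ that is labeled $x'$ at $v$ and, say, $y'$ at $u$, and every edge $y' - y$ of $\Gamma$, there is an edge between $(x,v)$ and $(y,u)$. The product depends on the chosen labeling. *)

theory Defs
  imports Main "HOL-Combinatorics.Permutations"
begin

section \<open>Undirected multigraphs\<close>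

text \<open>
  An undirected graph with loops and multiple edges is given by its edge ends (\<^emph>\<open>darts\<close>): a dart
  is an edge together with the choice of one of the vertices at which it is attached, and
  \<^emph>\<open>opp\<close> passes to the other end of the same edge.  The undirected edges are the orbits
  of \<^emph>\<open>opp\<close>, and the degree of a vertex is the number of darts based at it.  A loop is
  either a pair of darts exchanged by \<^emph>\<open>opp\<close> (contributing 2 to the degree) or a single dart
  fixed by \<^emph>\<open>opp\<close> (contributing 1).  The latter occur in action graphs, when a generator that is
  its own formal inverse fixes a vertex, and are needed for those graphs to be regular of
  degree equal to the number of generators.
\<close>

record ('v, 'e) mgraph =
  verts :: "'v set"
  darts :: "'e set"
  src :: "'e \<Rightarrow> 'v"
  opp :: "'e \<Rightarrow> 'e"

definition tgt :: "('v, 'e) mgraph \<Rightarrow> 'e \<Rightarrow> 'v" where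
  "tgt G e = src G (opp G e)"

definition multigraph :: "('v, 'e) mgraph \<Rightarrow> bool" where
  "multigraph G \<longleftrightarrow>
     (\<forall>e\<in>darts G. src G e \<in> verts G \<and> opp G e \<in> darts G \<and> opp G (opp G e) = e)"

text \<open>
  Equality of graphs with multiplicities: the same vertices, and a bijection between the edges
  that preserves the vertices at which each edge is attached.  The names of the edges are
  immaterial; vertices are not permuted.
\<close>

definition graph_eq :: "('v, 'e) mgraph \<Rightarrow> ('v, 'f) mgraph \<Rightarrow> bool" where
  "graph_eq G H \<longleftrightarrow> verts G = verts H \<and>
     (\<exists>\<phi>. bij_betw \<phi> (darts G) (darts H) \<and>
        (\<forall>e\<in>darts G. src H (\<phi> e) = src G e \<and> opp H (\<phi> e) = \<phi> (opp G e)))"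

definition rename_verts :: "('v \<Rightarrow> 'u) \<Rightarrow> ('v, 'e) mgraph \<Rightarrow> ('u, 'e) mgraph" where
  "rename_verts h G =
     \<lparr>verts = h ` verts G, darts = darts G, src = h \<circ> src G, opp = opp G\<rparr>"

text \<open>
  In the action graph, \<^emph>\<open>S\<close> is a set of formal generators, \<^emph>\<open>si\<close> the formal inversion on it and
  \<^emph>\<open>a\<close> the action.  The dart \<^emph>\<open>(s, v)\<close> is the end at \<^emph>\<open>v\<close> of the edge given by \<^emph>\<open>s\<close> at \<^emph>\<open>v\<close>.
\<close>

definition action_graph ::
  "'s set \<Rightarrow> ('s \<Rightarrow> 's) \<Rightarrow> ('s \<Rightarrow> 'v \<Rightarrow> 'v) \<Rightarrow> 'v set \<Rightarrow> ('v, 's \<times> 'v) mgraph" where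
  "action_graph S si a V =
     \<lparr>verts = V, darts = S \<times> V, src = snd, opp = (\<lambda>(s, v). (si s, a s v))\<rparr>"

lemma multigraph_action_graph:
  assumes "\<And>s. s \<in> S \<Longrightarrow> si s \<in> S" and "\<And>s. s \<in> S \<Longrightarrow> si (si s) = s"
    and "\<And>s v. s \<in> S \<Longrightarrow> v \<in> V \<Longrightarrow> a s v \<in> V"
    and "\<And>s v. s \<in> S \<Longrightarrow> v \<in> V \<Longrightarrow> a (si s) (a s v) = v"
  shows "multigraph (action_graph S si a V)"
  using assms by (auto simp: multigraph_def action_graph_def)

text \<open>Walks are sequences of darts, from a given starting vertex.\<close>

primrec is_walk :: "('v, 'e) mgraph \<Rightarrow> 'v \<Rightarrow> 'e list \<Rightarrow> bool" where
  "is_walk G v [] \<longleftrightarrow> v \<in> verts G"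
| "is_walk G v (e # p) \<longleftrightarrow> e \<in> darts G \<and> src G e = v \<and> is_walk G (tgt G e) p"

primrec walk_end :: "('v, 'e) mgraph \<Rightarrow> 'v \<Rightarrow> 'e list \<Rightarrow> 'v" where
  "walk_end G v [] = v"
| "walk_end G v (e # p) = walk_end G (tgt G e) p"

definition graph_power :: "('v, 'e) mgraph \<Rightarrow> nat \<Rightarrow> ('v, 'v \<times> 'e list) mgraph" where
  "graph_power G k =
     \<lparr>verts = verts G,
      darts = {(v, p). is_walk G v p \<and> length p = k},
      src = fst,
      opp = (\<lambda>(v, p). (walk_end G v p, rev (map (opp G) p)))\<rparr>"

lemma multigraph_graph_power:
  assumes "multigraph G"
  shows "multigraph (graph_power G k)"
proof -
  have src: "src G e \<in> verts G" and opp: "opp G e \<in> darts G" and opp2: "opp G (opp G e) = e"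
    if "e \<in> darts G" for e
    using assms that by (auto simp: multigraph_def)
  have start: "v \<in> verts G" if "is_walk G v p" for v p
    using that src by (cases p) auto
  have snoc: "is_walk G v (p @ [e]) \<and> walk_end G v (p @ [e]) = tgt G e"
    if "is_walk G v p" "walk_end G v p = src G e" "e \<in> darts G" for v p e
    using that by (induction p arbitrary: v) (auto simp: tgt_def intro: src opp)
  have reverse: "is_walk G (walk_end G v p) (rev (map (opp G) p))
      \<and> walk_end G (walk_end G v p) (rev (map (opp G) p)) = v"
    if "is_walk G v p" for v p
    using that
  proof (induction p arbitrary: v)
    case (Cons e p)
    then have e: "e \<in> darts G" "src G e = v" "is_walk G (tgt G e) p"
      by auto
    show ?case
      using snoc[of "walk_end G (tgt G e) p" "rev (map (opp G) p)" "opp G e"]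
        Cons.IH[OF e(3)] e opp opp2 by (simp add: tgt_def)
  qed simp
  have opp_map: "map (opp G \<circ> opp G) p = p" if "is_walk G v p" for v p
    using that by (induction p arbitrary: v) (auto simp: opp2)
  show ?thesis
    unfolding multigraph_def graph_power_def
    using start reverse opp_map by (auto simp: rev_map)
qed

section \<open>The zig-zag product\<close>

text \<open>
  A labeling gives every dart a label; it is one-to-one onto \<^emph>\<open>L\<close> at each vertex.  An edge
  has a label at each of its ends, that of \<^emph>\<open>e\<close> and that of \<^emph>\<open>opp G e\<close>.
\<close>

definition edge_labeling :: "('v, 'e) mgraph \<Rightarrow> 'x set \<Rightarrow> ('e \<Rightarrow> 'x) \<Rightarrow> bool" where
  "edge_labeling G L lab \<longleftrightarrow>
     (\<forall>v\<in>verts G. bij_betw lab {e \<in> darts G. src G e = v} L)"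

text \<open>
  A dart of the product at \<^emph>\<open>(x, v)\<close> consists of an edge \<^emph>\<open>e\<close> from \<^emph>\<open>x\<close> to \<^emph>\<open>x'\<close>, the edge \<^emph>\<open>f\<close>
  labeled \<^emph>\<open>x'\<close> at \<^emph>\<open>v\<close> and \<^emph>\<open>y'\<close> at its other end \<^emph>\<open>u\<close>, and an edge \<^emph>\<open>g\<close> from \<^emph>\<open>y'\<close> to \<^emph>\<open>y\<close>.
  Traversed backwards from \<^emph>\<open>(y, u)\<close>, the same edge consists of the opposites in reverse order.
\<close>

definition zigzag ::
  "('v, 'e) mgraph \<Rightarrow> ('e \<Rightarrow> 'x) \<Rightarrow> ('x, 'f) mgraph \<Rightarrow> ('x \<times> 'v, 'f \<times> 'e \<times> 'f) mgraph" where
  "zigzag G lab \<Gamma> =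
     \<lparr>verts = verts \<Gamma> \<times> verts G,
      darts = {(e, f, g). e \<in> darts \<Gamma> \<and> f \<in> darts G \<and> g \<in> darts \<Gamma> \<and>
                 tgt \<Gamma> e = lab f \<and> src \<Gamma> g = lab (opp G f)},
      src = (\<lambda>(e, f, g). (src \<Gamma> e, src G f)),
      opp = (\<lambda>(e, f, g). (opp \<Gamma> g, opp G f, opp \<Gamma> e))\<rparr>"

lemma multigraph_zigzag:
  assumes "multigraph G" "multigraph \<Gamma>"
  shows "multigraph (zigzag G lab \<Gamma>)"
  using assms by (auto simp: multigraph_def zigzag_def tgt_def)

section \<open>The wreath recursion\<close>

text \<open>The formal symbol \<^emph>\<open>s\<close> with index \<^emph>\<open>(\<pi>, \<tau>)\<close> is represented by the pair.\<close>

type_synonym symb = "(nat \<Rightarrow> nat) \<times> (nat \<Rightarrow> nat)"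

definition symb_inv :: "symb \<Rightarrow> symb" where
  "symb_inv = (\<lambda>(\<pi>, \<tau>). (inv \<tau>, inv \<pi>))"

definition word_inv :: "symb list \<Rightarrow> symb list" where
  "word_inv u = rev (map symb_inv u)"

definition words :: "(nat \<Rightarrow> nat) set \<Rightarrow> nat \<Rightarrow> symb list set" where
  "words P k = {u. set u \<subseteq> P \<times> P \<and> length u = k}"

text \<open>
  Below, \<^emph>\<open>w\<close> enumerates the words of length \<^emph>\<open>k\<close> by the elements of \<^emph>\<open>{1..d}\<close>.
\<close>

definition gamma :: "nat \<Rightarrow> (nat \<Rightarrow> symb list) \<Rightarrow> nat \<Rightarrow> nat" where
  "gamma d w x = the_inv_into {1..d} w (word_inv (w x))"

text \<open>
  The recursion calls the action of several symbols in succession on words of the same,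
  smaller length, so it is carried out on the length \<^emph>\<open>m\<close>.  The equations
  \<^emph>\<open>symb_act_Nil\<close> and \<^emph>\<open>symb_act_Cons\<close> below are the wreath recursion itself.
\<close>

primrec symb_act_level ::
  "nat \<Rightarrow> (nat \<Rightarrow> symb list) \<Rightarrow> nat \<Rightarrow> symb \<Rightarrow> nat list \<Rightarrow> nat list" where
  "symb_act_level d w 0 s v = v"
| "symb_act_level d w (Suc m) s v =
     snd s (gamma d w (fst s (hd v))) #
       foldr (symb_act_level d w m) (w (fst s (hd v))) (tl v)"

definition symb_act :: "nat \<Rightarrow> (nat \<Rightarrow> symb list) \<Rightarrow> symb \<Rightarrow> nat list \<Rightarrow> nat list" where
  "symb_act d w s v = symb_act_level d w (length v) s v"

definition word_act :: "nat \<Rightarrow> (nat \<Rightarrow> symb list) \<Rightarrow> symb list \<Rightarrow> nat list \<Rightarrow> nat list" where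
  "word_act d w u v = foldr (symb_act d w) u v"

lemma length_symb_act_level:
  "length v = m \<Longrightarrow> length (symb_act_level d w m s v) = m"
proof (induction m arbitrary: s v)
  case (Suc m)
  have "length (foldr (symb_act_level d w m) u (tl v)) = m" for u
    by (induction u) (use Suc in auto)
  then show ?case by simp
qed simp

lemma length_symb_act [simp]: "length (symb_act d w s v) = length v"
  by (simp add: symb_act_def length_symb_act_level)

lemma symb_act_Nil [simp]: "symb_act d w s [] = []"
  by (simp add: symb_act_def)

lemma length_word_act [simp]: "length (word_act d w u v) = length v"
  by (induction u) (simp_all add: word_act_def)

lemma symb_act_Cons [simp]:
  "symb_act d w (\<pi>, \<tau>) (x # v) = \<tau> (gamma d w (\<pi> x)) # word_act d w (w (\<pi> x)) v"
proof -
  have "foldr (symb_act_level d w (length v)) u v = word_act d w u v" for u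
  proof (induction u)
    case (Cons s u)
    then show ?case
      using length_word_act[of d w u v] by (simp add: word_act_def symb_act_def)
  qed (simp add: word_act_def)
  then show ?thesis by (simp add: symb_act_def)
qed

definition words_X :: "nat \<Rightarrow> nat \<Rightarrow> nat list set" where
  "words_X d n = {v. set v \<subseteq> {1..d} \<and> length v = n}"

definition Gamma_level ::
  "(nat \<Rightarrow> nat) set \<Rightarrow> nat \<Rightarrow> (nat \<Rightarrow> symb list) \<Rightarrow> nat \<Rightarrow> (nat list, symb \<times> nat list) mgraph" where
  "Gamma_level P d w n = action_graph (P \<times> P) symb_inv (symb_act d w) (words_X d n)"

definition Gamma_base ::
  "(nat \<Rightarrow> nat) set \<Rightarrow> nat \<Rightarrow> (nat, (nat \<Rightarrow> nat) \<times> nat) mgraph" where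
  "Gamma_base P d = action_graph P inv (\<lambda>\<pi> x. \<pi> x) {1..d}"

lemma multigraph_Gamma_base:
  assumes "\<forall>\<pi>\<in>P. \<pi> permutes {1..d}" and "\<forall>\<pi>\<in>P. inv \<pi> \<in> P"
  shows "multigraph (Gamma_base P d)"
  unfolding Gamma_base_def
proof (rule multigraph_action_graph)
  fix \<pi> x assume \<pi>: "\<pi> \<in> P"
  show "inv \<pi> \<in> P" using \<pi> assms(2) by blast
  show "inv (inv \<pi>) = \<pi>" using bspec[OF assms(1) \<pi>] by (rule permutes_inv_inv)
  show "inv \<pi> (\<pi> x) = x" using bspec[OF assms(1) \<pi>] by (simp add: permutes_inverses)
  show "\<pi> x \<in> {1..d}" if "x \<in> {1..d}"
    using bspec[OF assms(1) \<pi>] that by (simp only: permutes_in_image)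
qed

lemma gamma_props:
  assumes perm: "\<forall>\<pi>\<in>P. \<pi> permutes {1..d}" and symm: "\<forall>\<pi>\<in>P. inv \<pi> \<in> P"
    and w: "bij_betw w {1..d} (words P k)" and x: "x \<in> {1..d}"
  shows "gamma d w x \<in> {1..d}" and "w (gamma d w x) = word_inv (w x)"
    and "gamma d w (gamma d w x) = x"
proof -
  have inv_word: "word_inv u \<in> words P k" if "u \<in> words P k" for u
    using that symm by (auto simp: words_def word_inv_def symb_inv_def)
  have inv_inv: "word_inv (word_inv u) = u" if "u \<in> words P k" for u
  proof -
    have "symb_inv (symb_inv s) = s" if "s \<in> set u" for s
    proof -
      have "s \<in> P \<times> P" using that \<open>u \<in> words P k\<close> by (auto simp: words_def)
      then show ?thesis using permutes_inv_inv[OF perm[rule_format]] by (auto simp: symb_inv_def)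
    qed
    then have "map (symb_inv \<circ> symb_inv) u = u" by (simp add: map_idI)
    then show ?thesis by (simp add: word_inv_def rev_map)
  qed
  have inj: "inj_on w {1..d}" and img: "w ` {1..d} = words P k"
    using w by (auto simp: bij_betw_def)
  have g: "gamma d w y \<in> {1..d} \<and> w (gamma d w y) = word_inv (w y)" if "y \<in> {1..d}" for y
  proof -
    have "word_inv (w y) \<in> w ` {1..d}" using that inv_word img by blast
    then show ?thesis
      unfolding gamma_def
      using f_the_inv_into_f[OF inj] the_inv_into_into[OF inj _ subset_refl] by blast
  qed
  then show g1: "gamma d w x \<in> {1..d}" and g2: "w (gamma d w x) = word_inv (w x)"
    using x by auto
  have "w x \<in> words P k" using x img by blast
  then have "w (gamma d w (gamma d w x)) = w x" using g[OF g1] g2 inv_inv by simp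
  then show "gamma d w (gamma d w x) = x" using inj_onD[OF inj] g[OF g1] x by blast
qed

lemma symb_act_inverse:
  assumes perm: "\<forall>\<pi>\<in>P. \<pi> permutes {1..d}" and symm: "\<forall>\<pi>\<in>P. inv \<pi> \<in> P"
    and w: "bij_betw w {1..d} (words P k)"
  shows "set v \<subseteq> {1..d} \<Longrightarrow> s \<in> P \<times> P \<Longrightarrow>
    set (symb_act d w s v) \<subseteq> {1..d} \<and> symb_act d w (symb_inv s) (symb_act d w s v) = v"
proof (induction "length v" arbitrary: v s)
  case (Suc m)
  then obtain x u where v: "v = x # u" "length u = m" "x \<in> {1..d}" "set u \<subseteq> {1..d}"
    by (cases v) auto
  obtain \<pi> \<tau> where s: "s = (\<pi>, \<tau>)" "\<pi> \<in> P" "\<tau> \<in> P" using Suc.prems by blast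
  note g = gamma_props[of P d w k, OF perm symm w]
  have \<pi>x: "\<pi> x \<in> {1..d}" using bspec[OF perm s(2)] v(3) by (simp only: permutes_in_image)
  have \<tau>x: "\<tau> (gamma d w (\<pi> x)) \<in> {1..d}"
    using bspec[OF perm s(3)] g(1)[OF \<pi>x] by (simp only: permutes_in_image)
  have words: "set (word_act d w a u) \<subseteq> {1..d}
      \<and> word_act d w (word_inv a) (word_act d w a u) = u" if "set a \<subseteq> P \<times> P" for a
    using that
  proof (induction a)
    case Nil
    then show ?case using v by (simp add: word_act_def word_inv_def)
  next
    case (Cons t a)
    have IH: "set (word_act d w a u) \<subseteq> {1..d}"
        "word_act d w (word_inv a) (word_act d w a u) = u"
      using Cons by auto
    have "set (symb_act d w t (word_act d w a u)) \<subseteq> {1..d} \<and>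
        symb_act d w (symb_inv t) (symb_act d w t (word_act d w a u)) = word_act d w a u"
      by (rule Suc.hyps(1)) (use IH v Cons.prems in auto)
    with IH(2) show ?case by (simp add: word_act_def word_inv_def)
  qed
  have "w (\<pi> x) \<in> words P k" using w \<pi>x by (auto simp: bij_betw_def)
  then have wx: "set (w (\<pi> x)) \<subseteq> P \<times> P" by (simp add: words_def)
  have "inv \<tau> (\<tau> y) = y" "inv \<pi> (\<pi> y) = y" for y
    using permutes_inverses(2)[OF bspec[OF perm]] s(2,3) by blast+
  then show ?case
    using words[OF wx] \<tau>x g(2,3)[OF \<pi>x] by (simp add: s(1) v(1) symb_inv_def del: atLeastAtMost_iff)
qed simp

lemma multigraph_Gamma_level:
  assumes "\<forall>\<pi>\<in>P. \<pi> permutes {1..d}" and "\<forall>\<pi>\<in>P. inv \<pi> \<in> P"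
    and "bij_betw w {1..d} (words P k)"
  shows "multigraph (Gamma_level P d w n)"
  unfolding Gamma_level_def
proof (rule multigraph_action_graph)
  fix s v assume s: "s \<in> P \<times> P"
  show "symb_inv s \<in> P \<times> P" using s assms(2) by (auto simp: symb_inv_def)
  show "symb_inv (symb_inv s) = s"
    using s permutes_inv_inv[OF assms(1)[rule_format]] by (auto simp: symb_inv_def)
  assume v: "v \<in> words_X d n"
  show "symb_act d w s v \<in> words_X d n" "symb_act d w (symb_inv s) (symb_act d w s v) = v"
    using symb_act_inverse[OF assms, of v s] s v by (auto simp: words_X_def)
qed

text \<open>
  A walk in \<^emph>\<open>Gamma_level\<close> from \<^emph>\<open>v\<close> applies the symbols of a word to \<^emph>\<open>v\<close>, the last symbol first
  since words act from the left.  The walk is labeled by the index of this word.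
\<close>

definition word_label ::
  "nat \<Rightarrow> (nat \<Rightarrow> symb list) \<Rightarrow> nat list \<times> (symb \<times> nat list) list \<Rightarrow> nat" where
  "word_label d w = (\<lambda>(v, p). the_inv_into {1..d} w (rev (map fst p)))"

end

theory Submission
  imports Defs
begin

text \<open>
  A walk of length \<^emph>\<open>k\<close> in \<^emph>\<open>Gamma_level\<close> is determined by its starting vertex \<^emph>\<open>v\<close> and
  the word read along it, so the dart of the power with source \<^emph>\<open>v\<close> and label \<^emph>\<open>x\<close> is unique;
  it ends at \<^emph>\<open>w x\<close> applied to \<^emph>\<open>v\<close>, and its opposite is labeled \<^emph>\<open>gamma x\<close>, because reversing
  a walk inverts its word.  The wreath recursion for \<^emph>\<open>(\<pi>, \<tau>)\<close> at \<^emph>\<open>x v\<close> then spells out a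
  dart of the zig-zag product: the edge of \<^emph>\<open>\<pi>\<close> at \<^emph>\<open>x\<close>, the dart labeled \<^emph>\<open>\<pi> x\<close> at \<^emph>\<open>v\<close>,
  whose other end is labeled \<^emph>\<open>gamma (\<pi> x)\<close>, and the edge of \<^emph>\<open>\<tau>\<close> there.
\<close>

text \<open>A dart of an action graph records its source, so the walk reading given symbols from
  \<open>v\<close> is forced. Here the head acts first, as \<open>fold\<close> does, whereas words
  act through \<open>foldr\<close>; hence the reversals below.\<close>

primrec trace :: "('s \<Rightarrow> 'v \<Rightarrow> 'v) \<Rightarrow> 'v \<Rightarrow> 's list \<Rightarrow> ('s \<times> 'v) list" where
  "trace a v [] = []"
| "trace a v (s # ss) = (s, v) # trace a (a s v) ss"

lemma map_fst_trace [simp]: "map fst (trace a v ss) = ss"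
  by (induction ss arbitrary: v) auto

lemma length_trace [simp]: "length (trace a v ss) = length ss"
  by (induction ss arbitrary: v) auto

text \<open>The fixed-point equation for \<open>trace\<close> encodes that consecutive darts fit
  together, leaving only the start and the symbols free; closure of \<open>V\<close> under the
  action keeps every later vertex in \<open>V\<close>.\<close>

lemma is_walk_action_graph_iff:
  assumes "\<And>s v. s \<in> S \<Longrightarrow> v \<in> V \<Longrightarrow> a s v \<in> V"
  shows "is_walk (action_graph S si a V) v p \<longleftrightarrow>
    v \<in> V \<and> set (map fst p) \<subseteq> S \<and> trace a v (map fst p) = p"
  using assms by (induction p arbitrary: v) (auto simp: action_graph_def tgt_def)

lemma walk_end_trace_action_graph:
  "walk_end (action_graph S si a V) v (trace a v ss) = fold a ss v"
  by (induction ss arbitrary: v) (auto simp: action_graph_def tgt_def)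

lemma map_fst_opp_action_graph:
  "map fst (map (opp (action_graph S si a V)) p) = map si (map fst p)"
  by (auto simp: action_graph_def)

locale wreath_recursion =
  fixes k d :: nat and P :: "(nat \<Rightarrow> nat) set" and w :: "nat \<Rightarrow> symb list"
  assumes perm: "\<forall>\<pi>\<in>P. \<pi> permutes {1..d}"
    and symm: "\<forall>\<pi>\<in>P. inv \<pi> \<in> P"
    and w: "bij_betw w {1..d} (words P k)"
begin

abbreviation power_graph :: "nat \<Rightarrow> (nat list, nat list \<times> (symb \<times> nat list) list) mgraph" where
  "power_graph n \<equiv> graph_power (Gamma_level P d w n) k"

definition labeled_dart :: "nat list \<Rightarrow> nat \<Rightarrow> nat list \<times> (symb \<times> nat list) list" where
  "labeled_dart v x = (v, trace (symb_act d w) v (rev (w x)))"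

lemmas gamma_in = gamma_props(1)[OF perm symm w]
  and gamma_gamma = gamma_props(3)[OF perm symm w]

lemma perm_in: "\<pi> \<in> P \<Longrightarrow> x \<in> {1..d} \<Longrightarrow> \<pi> x \<in> {1..d}"
  using perm by (simp only: permutes_in_image)

lemma inv_perm: "\<pi> \<in> P \<Longrightarrow> inv \<pi> (\<pi> x) = x"
  using permutes_inverses(2)[OF bspec[OF perm]] .

lemma w_in: "x \<in> {1..d} \<Longrightarrow> w x \<in> words P k"
  using w by (auto simp: bij_betw_def)

lemma the_inv_w: "x \<in> {1..d} \<Longrightarrow> the_inv_into {1..d} w (w x) = x"
  using w by (simp add: bij_betw_def the_inv_into_f_f)

lemma w_the_inv: "u \<in> words P k \<Longrightarrow> w (the_inv_into {1..d} w u) = u"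
  using w by (simp add: bij_betw_def f_the_inv_into_f)

lemma the_inv_in: "u \<in> words P k \<Longrightarrow> the_inv_into {1..d} w u \<in> {1..d}"
  using w the_inv_into_into[of w "{1..d}" u "{1..d}"] by (simp add: bij_betw_def)

lemma symb_act_in: "s \<in> P \<times> P \<Longrightarrow> v \<in> words_X d n \<Longrightarrow> symb_act d w s v \<in> words_X d n"
  using symb_act_inverse[OF perm symm w, of v s] by (simp add: words_X_def)

lemma darts_power_graph_iff:
  "(v, p) \<in> darts (power_graph n) \<longleftrightarrow>
    v \<in> words_X d n \<and> rev (map fst p) \<in> words P k \<and> trace (symb_act d w) v (map fst p) = p"
proof -
  have "is_walk (Gamma_level P d w n) v p \<longleftrightarrow>
      v \<in> words_X d n \<and> set (map fst p) \<subseteq> P \<times> P \<and> trace (symb_act d w) v (map fst p) = p"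
    unfolding Gamma_level_def by (rule is_walk_action_graph_iff) (rule symb_act_in)
  then show ?thesis
    by (auto simp: graph_power_def words_def)
qed

lemma labeled_dart_in:
  assumes "v \<in> words_X d n" "x \<in> {1..d}"
  shows "labeled_dart v x \<in> darts (power_graph n)"
  using assms w_in[of x] by (simp add: labeled_dart_def darts_power_graph_iff)

lemma src_labeled_dart [simp]: "src (power_graph n) (labeled_dart v x) = v"
  by (simp add: graph_power_def labeled_dart_def)

lemma label_labeled_dart: "x \<in> {1..d} \<Longrightarrow> word_label d w (labeled_dart v x) = x"
  using the_inv_w by (simp add: labeled_dart_def word_label_def)

lemma label_in: "e \<in> darts (power_graph n) \<Longrightarrow> word_label d w e \<in> {1..d}"
  using the_inv_in by (cases e) (simp add: darts_power_graph_iff word_label_def)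

lemma src_in: "e \<in> darts (power_graph n) \<Longrightarrow> src (power_graph n) e \<in> words_X d n"
  by (cases e) (simp only: darts_power_graph_iff, simp add: graph_power_def)

text \<open>The label recovers the word through \<open>w\<close>, and a walk is the trace of its own
  symbols. This gives injectivity of the labeling at each vertex.\<close>

lemma labeled_dart_eq:
  assumes "e \<in> darts (power_graph n)"
  shows "labeled_dart (src (power_graph n) e) (word_label d w e) = e"
proof (cases e)
  case (Pair v p)
  then show ?thesis
    using assms w_the_inv
    by (simp add: darts_power_graph_iff labeled_dart_def word_label_def)
      (simp add: graph_power_def)
qed

lemma edge_labeling_power_graph: "edge_labeling (power_graph n) {1..d} (word_label d w)"
  unfolding edge_labeling_def
proof
  fix v assume "v \<in> verts (power_graph n)"
  then have v: "v \<in> words_X d n"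
    by (simp add: graph_power_def Gamma_level_def action_graph_def)
  show "bij_betw (word_label d w)
      {e \<in> darts (power_graph n). src (power_graph n) e = v} {1..d}"
    by (rule bij_betw_byWitness[where f' = "labeled_dart v"])
      (use v in \<open>auto simp del: atLeastAtMost_iff One_nat_def
        simp: label_labeled_dart label_in labeled_dart_in dest: labeled_dart_eq\<close>)
qed

text \<open>By \<open>labeled_dart_eq\<close> it suffices to compare source and label. In the label,
  the reversal of the walk cancels the one in \<open>word_label\<close>, leaving
  \<open>word_inv (w x)\<close>, whose index is \<open>gamma d w x\<close> by definition.\<close>

lemma opp_labeled_dart:
  assumes v: "v \<in> words_X d n" and x: "x \<in> {1..d}"
  shows "opp (power_graph n) (labeled_dart v x) =
    labeled_dart (word_act d w (w x) v) (gamma d w x)"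
proof -
  let ?e = "opp (power_graph n) (labeled_dart v x)"
  have "?e \<in> darts (power_graph n)"
    using multigraph_graph_power[OF multigraph_Gamma_level[OF perm symm w]]
      labeled_dart_in[OF v x] unfolding multigraph_def by blast
  moreover have "src (power_graph n) ?e = word_act d w (w x) v"
    by (simp add: graph_power_def labeled_dart_def Gamma_level_def
        walk_end_trace_action_graph word_act_def foldr_conv_fold)
  moreover have "word_label d w ?e = gamma d w x"
    using map_fst_opp_action_graph[of "P \<times> P" symb_inv "symb_act d w" "words_X d n"
        "trace (symb_act d w) v (rev (w x))"]
    by (simp add: graph_power_def labeled_dart_def Gamma_level_def word_label_def gamma_def
        word_inv_def rev_map)
  ultimately show ?thesis
    using labeled_dart_eq by metis
qed

lemma graph_eq_zigzag:
  "graph_eq (Gamma_level P d w (n + 1))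
    (rename_verts (\<lambda>(x, v). x # v)
      (zigzag (power_graph n) (word_label d w) (Gamma_base P d)))"
  (is "graph_eq ?A (rename_verts ?h ?Z)")
proof -
  \<comment> \<open>The label of the middle dart has to be the target \<open>\<pi> (hd u)\<close> of
    the first edge; the last edge then has to start at the label of the opposite dart.\<close>
  define \<phi> where "\<phi> = (\<lambda>((\<pi>, \<tau>), u).
    ((\<pi>, hd u), labeled_dart (tl u) (\<pi> (hd u)), (\<tau> :: nat \<Rightarrow> nat, gamma d w (\<pi> (hd u)))))"
  \<comment> \<open>Dropping \<open>y\<close> and keeping only the source of \<open>f\<close> loses
    nothing: the incidence conditions determine both \<open>y\<close> and the label of
    \<open>f\<close>.\<close>
  define \<psi> where "\<psi> = (\<lambda>((\<pi> :: nat \<Rightarrow> nat, x :: nat), f, (\<tau> :: nat \<Rightarrow> nat, y :: nat)).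
    ((\<pi>, \<tau>), x # src (power_graph n) f))"
  have words_Suc: "u \<in> words_X d (n + 1) \<longleftrightarrow>
      (\<exists>x v. u = x # v \<and> x \<in> {1..d} \<and> v \<in> words_X d n)" for u
    by (cases u) (auto simp: words_X_def)
  have dA: "e \<in> darts ?A \<longleftrightarrow> (\<exists>\<pi> \<tau> x v. e = ((\<pi>, \<tau>), x # v) \<and> \<pi> \<in> P \<and> \<tau> \<in> P
      \<and> x \<in> {1..d} \<and> v \<in> words_X d n)" for e
    by (cases e) (simp add: Gamma_level_def action_graph_def words_Suc[simplified]; blast)
  have opp_label: "word_label d w (opp (power_graph n) (labeled_dart v x)) = gamma d w x"
    if "v \<in> words_X d n" "x \<in> {1..d}" for v x
    using that by (simp only: opp_labeled_dart label_labeled_dart gamma_in)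
  \<comment> \<open>The darts of the product get the same free parameters \<open>\<pi>\<close>,
    \<open>\<tau>\<close>, \<open>x\<close>, \<open>v\<close> as those of \<open>?A\<close> in
    \<open>dA\<close>, so both inverse laws become computations.\<close>
  have dZ: "e \<in> darts ?Z \<longleftrightarrow> (\<exists>\<pi> \<tau> x v. e = ((\<pi>, x), labeled_dart v (\<pi> x), (\<tau>, gamma d w (\<pi> x)))
      \<and> \<pi> \<in> P \<and> \<tau> \<in> P \<and> x \<in> {1..d} \<and> v \<in> words_X d n)" (is "_ \<longleftrightarrow> ?R e") for e
  proof
    assume "e \<in> darts ?Z"
    then obtain \<pi> x f \<tau> y where e: "e = ((\<pi>, x), f, (\<tau>, y))" "\<pi> \<in> P" "\<tau> \<in> P" "x \<in> {1..d}"
        "f \<in> darts (power_graph n)" "\<pi> x = word_label d w f"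
        "y = word_label d w (opp (power_graph n) f)"
      by (auto simp: zigzag_def Gamma_base_def action_graph_def tgt_def)
    have f: "f = labeled_dart (src (power_graph n) f) (\<pi> x)"
      using labeled_dart_eq[OF e(5)] e(6) by simp
    have "y = gamma d w (\<pi> x)"
      using opp_label[OF src_in[OF e(5)] perm_in[OF e(2,4)]] f e(7) by simp
    then show "?R e"
      using e f src_in[OF e(5)] by blast
  next
    assume "?R e"
    then obtain \<pi> \<tau> x v where e: "e = ((\<pi>, x), labeled_dart v (\<pi> x), (\<tau>, gamma d w (\<pi> x)))"
      "\<pi> \<in> P" "\<tau> \<in> P" "x \<in> {1..d}" "v \<in> words_X d n" by blast
    have \<pi>x: "\<pi> x \<in> {1..d}" using perm_in e by blast
    show "e \<in> darts ?Z"
      using e labeled_dart_in[OF e(5) \<pi>x] label_labeled_dart[OF \<pi>x, of v]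
        opp_label[OF e(5) \<pi>x] gamma_in[OF \<pi>x]
      by (simp add: zigzag_def Gamma_base_def action_graph_def tgt_def)
  qed
  have "bij_betw \<phi> (darts ?A) (darts ?Z)"
  proof (rule bij_betw_byWitness[where f' = \<psi>])
    show "\<forall>e\<in>darts ?A. \<psi> (\<phi> e) = e"
      unfolding \<phi>_def \<psi>_def Ball_def dA by auto
    show "\<forall>e\<in>darts ?Z. \<phi> (\<psi> e) = e"
      unfolding \<phi>_def \<psi>_def Ball_def dZ by auto
    show "\<phi> ` darts ?A \<subseteq> darts ?Z"
      unfolding \<phi>_def subset_iff image_iff Bex_def dA dZ by fastforce
    show "\<psi> ` darts ?Z \<subseteq> darts ?A"
      unfolding \<psi>_def subset_iff image_iff Bex_def dA dZ by fastforce
  qed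
  moreover have "src (rename_verts ?h ?Z) (\<phi> e) = src ?A e \<and>
      opp (rename_verts ?h ?Z) (\<phi> e) = \<phi> (opp ?A e)" if "e \<in> darts ?A" for e
  proof -
    obtain \<pi> \<tau> x v where e: "e = ((\<pi>, \<tau>), x # v)"
      "\<pi> \<in> P" "\<tau> \<in> P" "x \<in> {1..d}" "v \<in> words_X d n" using \<open>e \<in> darts ?A\<close> unfolding dA by blast
    have \<pi>x: "\<pi> x \<in> {1..d}" using perm_in e by blast
    have "src ?A e = x # v"
      "opp ?A e = ((inv \<tau>, inv \<pi>), \<tau> (gamma d w (\<pi> x)) # word_act d w (w (\<pi> x)) v)"
      by (simp_all add: e(1) Gamma_level_def action_graph_def symb_inv_def)
    \<comment> \<open>In \<open>\<phi>\<close> of the opposite dart, \<open>inv \<tau>\<close>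
      cancels \<open>\<tau>\<close>, so the middle label is \<open>gamma d w (\<pi> x)\<close>; the
      last edge then starts at \<open>\<pi> x\<close>, since \<open>gamma d w\<close> is an
      involution on {1..d}. These are the three opposites in reverse order.\<close>
    then show ?thesis
      using opp_labeled_dart[OF e(5) \<pi>x] gamma_gamma[OF \<pi>x] e(2,3)
      by (simp add: e(1) \<phi>_def rename_verts_def zigzag_def Gamma_base_def action_graph_def
          inv_perm)
  qed
  moreover have "verts ?A = verts (rename_verts ?h ?Z)"
    by (auto simp: rename_verts_def zigzag_def Gamma_base_def Gamma_level_def
        graph_power_def action_graph_def words_Suc[simplified] image_iff)
  ultimately show ?thesis
    unfolding graph_eq_def by (auto simp: rename_verts_def)
qed

end

theorem theorem3:
  fixes k d n :: nat
    and P :: "(nat \<Rightarrow> nat) set"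
    and w :: "nat \<Rightarrow> symb list"
  assumes "k \<ge> 1"
    and "\<forall>\<pi>\<in>P. \<pi> permutes {1..d}"
    and "\<forall>\<pi>\<in>P. inv \<pi> \<in> P"
    and "d = card P ^ (2 * k)"
    and "bij_betw w {1..d} (words P k)"
    and "n \<ge> 1"
  shows "let G = graph_power (Gamma_level P d w n) k; lab = word_label d w in
    edge_labeling G {1..d} lab \<and>
    (\<forall>v\<in>words_X d n. \<forall>x\<in>{1..d}. \<forall>e\<in>darts G. src G e = v \<and> lab e = x \<longrightarrow>
       tgt G e = word_act d w (w x) v \<and> lab (opp G e) = gamma d w x) \<and>
    graph_eq (Gamma_level P d w (n + 1))
      (rename_verts (\<lambda>(x, v). x # v) (zigzag G lab (Gamma_base P d)))"
proof -
  interpret wreath_recursion k d P w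
    using assms by unfold_locales
  let ?G = "graph_power (Gamma_level P d w n) k"
  have "tgt ?G e = word_act d w (w x) v \<and> word_label d w (opp ?G e) = gamma d w x"
    if "v \<in> words_X d n" "x \<in> {1..d}" "e \<in> darts ?G" "src ?G e = v \<and> word_label d w e = x"
    for v x e
  proof -
    have "e = labeled_dart v x"
      using labeled_dart_eq[OF that(3)] that(4) by simp
    then show ?thesis
      using that(1,2) by (simp only: tgt_def opp_labeled_dart src_labeled_dart
          label_labeled_dart gamma_in)
  qed
  then show ?thesis
    unfolding Let_def using edge_labeling_power_graph graph_eq_zigzag by blast
qed

end
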